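(* Let $G$ be a digraph that has a doubly bidirectionally connected pair $(p,q)$, and let $\varphi\colon G'\to G$ be an expansion of $G$. Then $G'$ is not a cactus digraph.
   Context: A digraph is a pair $G=(V,A)$ with $V$ a finite set of vertices and $A\subset V\times V$ a set of arcs, without loops: $(v,v)\notin A$ for all $v\in V$. An arc $(x,y)$ is an arc from $x$ to $y$. A path of length $n$ from $x$ to $y$ is a sequence of vertices $(x_0,x_1,\dots,x_n)$ with $x_0=x$, $x_n=y$ and $(x_{i-1},x_i)\in A$ for $1\le i\le n$. The vertex $x_{n-1}$ is called the preterminal vertex of the path. A path is simple if $x_0,\dots,x_n$ are distinct. A cycle is a path (of length $n\ge 1$) with $x_0=x_n$; it is simple if $x_0,\dots,x_{n-1}$ are distinct. Cycles are regarded as subdigraphs, i.e. cycles that differ only in the choice of starting vertex (cyclic rotation) are the same cycle. $G$ is strongly connected if for any $x,y\in V$ there is a path from $x$ to $y$. A digraph morphism $\varphi\colon G'\to G$ from $G'=(V',A')$ to $G=(V,A)$ is a pair of maps $\varphi_V\colon V'\to V$, $\varphi_A\colon A'\to A$ with $\varphi_A((v',w'))=(\varphi_V(v'),\varphi_V(w'))$ for every $(v',w')\in A'$. An expansion of $G$ is a digraph $G'=(V',A')$ together with a digraph morphism $\varphi\colon G'\to G$ such that $\varphi_V$ is surjective, $\varphi_A$ is surjective, and whenever $(x,y)\in A$, $y'\in V'$ and $\varphi_V(y')=y$, there exists a unique arc $(x',y')\in A'$ (with terminal vertex $y'$) such that $\varphi_V(x')=x$. A cactus digraph is a strongly connected digraph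 in which each arc is contained in exactly one simple cycle (the digraph with a single vertex and no arc is a cactus digraph). A doubly bidirectionally connected pair of $G=(V,A)$ is a pair $(p,q)\in V\times V$ such that $p\ne q$, there exist two simple paths from $p$ to $q$ with different preterminal vertices, and there exist two simple paths from $q$ to $p$ with different preterminal vertices. *)

theory Defs
  imports "Graph_Theory.Digraph_Component"
begin

text \<open>
  Digraphs are the \<open>pair_digraph\<close>s of the Graph Theory entry (finite, loop-free, arcs are pairs
  of vertices).  A path is given by its list of arcs and its end points (\<open>awalk\<close>); a path whose
  vertices are distinct is an \<open>apath\<close>.
\<close>

definition digraph_morphism ::
  "'b pair_pre_digraph \<Rightarrow> 'a pair_pre_digraph \<Rightarrow> ('b \<Rightarrow> 'a) \<Rightarrow> ('b \<times> 'b \<Rightarrow> 'a \<times> 'a) \<Rightarrow> bool" where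
  "digraph_morphism G' G \<phi>V \<phi>A \<longleftrightarrow>
     \<phi>V ` pverts G' \<subseteq> pverts G \<and> \<phi>A ` parcs G' \<subseteq> parcs G \<and>
     (\<forall>v' w'. (v', w') \<in> parcs G' \<longrightarrow> \<phi>A (v', w') = (\<phi>V v', \<phi>V w'))"

definition expansion ::
  "'b pair_pre_digraph \<Rightarrow> 'a pair_pre_digraph \<Rightarrow> ('b \<Rightarrow> 'a) \<Rightarrow> ('b \<times> 'b \<Rightarrow> 'a \<times> 'a) \<Rightarrow> bool" where
  "expansion G' G \<phi>V \<phi>A \<longleftrightarrow>
     pair_digraph G' \<and> digraph_morphism G' G \<phi>V \<phi>A \<and>
     \<phi>V ` pverts G' = pverts G \<and> \<phi>A ` parcs G' = parcs G \<and>
     (\<forall>x y y'. (x, y) \<in> parcs G \<and> y' \<in> pverts G' \<and> \<phi>V y' = y \<longrightarrow>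
        (\<exists>!x'. (x', y') \<in> parcs G' \<and> \<phi>V x' = x))"

text \<open>
  The library's \<open>cycle\<close> is a simple cycle of length at least 1 with a chosen starting point.
  Passing to the subdigraph it traces out identifies exactly the cyclic rotations.
\<close>

definition simple_cycles :: "'a pair_pre_digraph \<Rightarrow> 'a pair_pre_digraph set" where
  "simple_cycles G =
     {\<lparr>pverts = Field (set c), parcs = set c\<rparr> | c. pre_digraph.cycle (with_proj G) c}"

definition cactus_digraph :: "'a pair_pre_digraph \<Rightarrow> bool" where
  "cactus_digraph G \<longleftrightarrow>
     pair_digraph G \<and> strongly_connected (with_proj G) \<and>
     (\<forall>a \<in> parcs G. \<exists>!C. C \<in> simple_cycles G \<and> a \<in> parcs C)"

text \<open>Only meaningful for paths of length at least 1.\<close>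

definition preterminal :: "('a \<times> 'a) awalk \<Rightarrow> 'a" where
  "preterminal P = fst (last P)"

text \<open>The empty path cannot occur below, since \<open>p \<noteq> q\<close>.\<close>

definition doubly_bidirectionally_connected ::
  "'a pair_pre_digraph \<Rightarrow> 'a \<Rightarrow> 'a \<Rightarrow> bool" where
  "doubly_bidirectionally_connected G p q \<longleftrightarrow>
     p \<in> pverts G \<and> q \<in> pverts G \<and> p \<noteq> q \<and>
     (\<exists>P1 P2. pre_digraph.apath (with_proj G) p P1 q \<and> pre_digraph.apath (with_proj G) p P2 q \<and>
        preterminal P1 \<noteq> preterminal P2) \<and>
     (\<exists>Q1 Q2. pre_digraph.apath (with_proj G) q Q1 p \<and> pre_digraph.apath (with_proj G) q Q2 p \<and>
        preterminal Q1 \<noteq> preterminal Q2)"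

end

theory Submission
  imports Defs
begin

text \<open>
  For an arc \<open>(a, v)\<close> let \<open>R v a\<close> be the set of vertices that reach \<open>a\<close> without meeting \<open>v\<close>.
  In a cactus, \<open>R v a\<close> and \<open>R v b\<close> are disjoint for distinct arcs \<open>(a, v)\<close>, \<open>(b, v)\<close>: continuing
  a path from \<open>v\<close> to a common vertex in two ways gives two simple cycles with the same first arc.
  If \<open>v\<close> lies over \<open>p\<close> or \<open>q\<close>, then lifting the given paths backwards from \<open>v\<close> yields two
  distinct arcs \<open>(a, v)\<close> for which \<open>R v a\<close> contains a vertex \<open>w\<close> over the other one of \<open>p\<close>, \<open>q\<close>.
  By disjointness one of the two arcs \<open>(c, w)\<close> obtained at \<open>w\<close> satisfies \<open>v \<notin> R w c\<close>, and then
  \<open>R w c\<close> is a proper subset of \<open>R v a\<close>. This descent cannot go on forever.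
\<close>

definition reaching_avoiding :: "'a rel \<Rightarrow> 'a \<Rightarrow> 'a \<Rightarrow> 'a set" where
  "reaching_avoiding A v a = {x. (x, a) \<in> (Restr A (- {v}))\<^sup>*}"

lemma reaching_avoiding_self: "a \<in> reaching_avoiding A v a"
  by (simp add: reaching_avoiding_def)

lemma reaching_avoiding_neq:
  assumes "x \<in> reaching_avoiding A v a" "a \<noteq> v"
  shows "x \<noteq> v"
  using assms unfolding reaching_avoiding_def
  by (auto elim: converse_rtranclE)

text \<open>A coarse bound that does not mention \<open>v\<close>: it gives finiteness for the
  descent and places members among the vertices. The vertex \<open>a\<close> is inserted because it
  belongs even without an outgoing arc.\<close>

lemma reaching_avoiding_subset:
  "reaching_avoiding A v a \<subseteq> insert a (Domain A)"
  by (auto simp: reaching_avoiding_def elim: converse_rtranclE)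

text \<open>Every vertex on a walk to \<open>c\<close> that avoids \<open>w\<close> itself lies in
  \<open>reaching_avoiding A w c\<close>. As \<open>v\<close> is not in that set, the same walk
  misses \<open>v\<close>.\<close>

lemma reaching_avoiding_change_vertex:
  assumes x: "x \<in> reaching_avoiding A w c" and v: "v \<notin> reaching_avoiding A w c"
  shows "(x, c) \<in> (Restr A (- {v}))\<^sup>*"
  using x unfolding reaching_avoiding_def mem_Collect_eq
proof (induction rule: converse_rtrancl_induct)
  case base
  then show ?case by simp
next
  case (step y z)
  have "z \<noteq> v" using v step.hyps(2) by (auto simp: reaching_avoiding_def)
  moreover have "y \<noteq> v"
    using v converse_rtrancl_into_rtrancl[OF step.hyps(1,2)] by (auto simp: reaching_avoiding_def)
  ultimately show ?case
    using step by (auto intro: converse_rtrancl_into_rtrancl)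
qed

text \<open>A walk to \<open>c\<close> that misses \<open>v\<close> continues over the arc
  \<open>(c, w)\<close> and then from \<open>w\<close> to \<open>a\<close>, still missing
  \<open>v\<close>. The inclusion is strict because \<open>w\<close> itself lies only in the larger
  set.\<close>

lemma reaching_avoiding_psubset:
  assumes "(c, w) \<in> A" "c \<noteq> w" "a \<noteq> v"
    and w: "w \<in> reaching_avoiding A v a" and v: "v \<notin> reaching_avoiding A w c"
  shows "reaching_avoiding A w c \<subset> reaching_avoiding A v a"
proof -
  have "w \<noteq> v" using w \<open>a \<noteq> v\<close> by (rule reaching_avoiding_neq)
  moreover have "c \<noteq> v" using v reaching_avoiding_self by metis
  ultimately have "(c, a) \<in> (Restr A (- {v}))\<^sup>*"
    using \<open>(c, w) \<in> A\<close> w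
    by (auto simp: reaching_avoiding_def intro: converse_rtrancl_into_rtrancl)
  then have "reaching_avoiding A w c \<subseteq> reaching_avoiding A v a"
    using reaching_avoiding_change_vertex[OF _ v] rtrancl_trans
    by (fastforce simp: reaching_avoiding_def)
  moreover have "w \<notin> reaching_avoiding A w c"
    using reaching_avoiding_neq \<open>c \<noteq> w\<close> by metis
  ultimately show ?thesis using w by blast
qed

lemma reaching_avoiding_descent:
  assumes fin: "finite A" and irrefl: "\<And>x. (x, x) \<notin> A"
    and disj: "\<And>v a b. (a, v) \<in> A \<Longrightarrow> (b, v) \<in> A \<Longrightarrow> a \<noteq> b \<Longrightarrow>
      reaching_avoiding A v a \<inter> reaching_avoiding A v b = {}"
    and branch: "\<And>v. v \<in> T \<Longrightarrow> \<exists>a b. a \<noteq> b \<and> (a, v) \<in> A \<and> (b, v) \<in> A \<and>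
      T \<inter> reaching_avoiding A v a \<noteq> {} \<and> T \<inter> reaching_avoiding A v b \<noteq> {}"
  shows "T = {}"
proof -
  have finR: "finite (reaching_avoiding A v a)" for v a
    by (rule finite_subset[OF reaching_avoiding_subset]) (simp add: fin finite_Domain)
  \<comment> \<open>At any vertex of \<open>T\<close>, \<open>branch\<close> supplies an arc
    violating this claim, so the claim forces \<open>T\<close> to be empty.\<close>
  have no_return: "T \<inter> reaching_avoiding A v a = {}" if "(a, v) \<in> A" for v a
    using that
  proof (induction "card (reaching_avoiding A v a)" arbitrary: v a rule: less_induct)
    case less
    show ?case
    proof (rule ccontr)
      assume "T \<inter> reaching_avoiding A v a \<noteq> {}"
      then obtain w where w: "w \<in> T" "w \<in> reaching_avoiding A v a" by blast
      \<comment> \<open>By \<open>disj\<close>, \<open>v\<close> lies in at most one of the two sets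
        that \<open>branch\<close> gives at \<open>w\<close>; \<open>c\<close> belongs to one that
        misses \<open>v\<close>.\<close>
      obtain c where c: "(c, w) \<in> A" "T \<inter> reaching_avoiding A w c \<noteq> {}"
        "v \<notin> reaching_avoiding A w c"
        using branch[OF w(1)] disj by blast
      have "c \<noteq> w" "a \<noteq> v" using c(1) less.prems irrefl by auto
      then have "card (reaching_avoiding A w c) < card (reaching_avoiding A v a)"
        using reaching_avoiding_psubset[OF c(1)] w(2) c(3) psubset_card_mono[OF finR] by blast
      then show False using less.hyps c(1,2) by blast
    qed
  qed
  show ?thesis using branch no_return by blast
qed

text \<open>Cut the walk at its last visit to \<open>w\<close>. In the induction, a return to
  \<open>w\<close> discards what came before and restarts with the next arc.\<close>

lemma first_arc_avoiding:
  assumes "(w, x) \<in> A\<^sup>*" "x \<noteq> w"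
  shows "\<exists>y. (w, y) \<in> A \<and> y \<noteq> w \<and> (y, x) \<in> (Restr A (- {w}))\<^sup>*"
  using assms
proof (induction rule: rtrancl_induct)
  case (step x z)
  show ?case
  proof (cases "x = w")
    case True
    then show ?thesis using step by blast
  next
    case False
    then obtain y where y: "(w, y) \<in> A" "y \<noteq> w" "(y, x) \<in> (Restr A (- {w}))\<^sup>*"
      using step.IH by blast
    have "(y, z) \<in> (Restr A (- {w}))\<^sup>*"
      using y(3) False step by (auto intro: rtrancl_into_rtrancl)
    then show ?thesis using y by blast
  qed
qed simp

context pair_wf_digraph
begin

lemma rtrancl_subset_imp_apath:
  assumes "(y, c) \<in> B\<^sup>*" "B \<subseteq> parcs G" "c \<in> pverts G"
  shows "\<exists>P. apath y P c \<and> set P \<subseteq> B"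
proof -
  have "\<exists>P. awalk y P c \<and> set P \<subseteq> B"
    using assms(1)
  proof (induction rule: converse_rtrancl_induct)
    case base
    then show ?case using assms(3) by (auto simp: awalk_Nil_iff intro: exI[of _ "[]"])
  next
    case (step y z)
    then obtain P where "awalk z P c" "set P \<subseteq> B" by blast
    then have "awalk y ((y, z) # P) c \<and> set ((y, z) # P) \<subseteq> B"
      using step.hyps(1) assms(2) by (auto simp: awalk_Cons_iff)
    then show ?case by blast
  qed
  then show ?thesis using apath_awalk_to_apath awalk_to_apath_subset by blast
qed

text \<open>A simple path from \<open>y\<close> to \<open>c\<close> off \<open>w\<close> is closed
  up by the two arcs at \<open>w\<close>. The set of predecessors of \<open>w\<close> is recorded
  because it depends only on the arc set of the cycle, so it can tell two cycles apart as
  subdigraphs.\<close>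

lemma cycle_through_arcs:
  assumes "(w, y) \<in> parcs G" "y \<noteq> w" "(c, w) \<in> parcs G"
    and "(y, c) \<in> (Restr (parcs G) (- {w}))\<^sup>*"
  shows "\<exists>C. cycle C \<and> (w, y) \<in> set C \<and> {u. (u, w) \<in> set C} = {c}"
proof -
  have "c \<in> pverts G" using assms(3) by (rule in_arcsD1)
  then obtain P where P: "apath y P c" "set P \<subseteq> Restr (parcs G) (- {w})"
    using rtrancl_subset_imp_apath[OF assms(4)] by blast
  have walk: "awalk y P c" and dist: "distinct (pawalk_verts y P)"
    using P(1) by (auto simp: apath_def)
  have w: "w \<notin> set (pawalk_verts y P)"
    using set_awalk_verts[OF walk] P(2) assms(2) by auto
  let ?C = "(w, y) # P @ [(c, w)]"
  have "awalk y (P @ [(c, w)]) w"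
    using assms(3) by (intro awalk_appendI[OF walk]) (simp add: awalk_simps in_arcsD2)
  then have walkC: "awalk w ?C w" using assms(1) by (simp add: awalk_Cons_iff walk del: awalk_append_iff)
  have "pawalk_verts y (P @ [(c, w)]) = pawalk_verts y P @ [w]"
    using awalk_verts_append[OF \<open>awalk y (P @ [(c, w)]) w\<close>] by simp
  \<comment> \<open>Taking the tail drops the starting \<open>w\<close>, so \<open>w\<close> is
    counted only once, at the end.\<close>
  then have "distinct (tl (pawalk_verts w ?C))" using dist w by simp
  then have "cycle ?C" using walkC unfolding cycle_def by blast
  moreover have "{u. (u, w) \<in> set ?C} = {c}" using P(2) assms(2) by auto
  ultimately show ?thesis by (intro exI[of _ ?C]) auto
qed

text \<open>A simple path meets \<open>v\<close> only at its end, so it stays off \<open>v\<close>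
  until its last arc. The condition \<open>u \<noteq> v\<close> excludes the empty path, whose
  \<open>preterminal\<close> is meaningless.\<close>

lemma apath_imp_reaching_avoiding:
  assumes "apath u P v" "u \<noteq> v"
  shows "u \<in> reaching_avoiding (parcs G) v (preterminal P) \<and> (preterminal P, v) \<in> parcs G"
  using assms
proof (induction P arbitrary: u)
  case Nil
  then show ?case by (simp add: apath_simps)
next
  case (Cons e P)
  then have e: "e \<in> parcs G" "fst e = u" and P: "apath (snd e) P v"
    by (auto simp: apath_simps)
  show ?case
  proof (cases "snd e = v")
    case True
    then have "P = []" using P apath_nonempty_ends by blast
    then show ?thesis
      using e True by (cases e) (simp add: preterminal_def reaching_avoiding_self)
  next
    case False
    then have "P \<noteq> []" using P by (auto simp: apath_simps)
    then have "preterminal (e # P) = preterminal P" by (simp add: preterminal_def)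
    moreover have "(u, snd e) \<in> Restr (parcs G) (- {v})"
      using e False Cons.prems by (cases e) auto
    ultimately show ?thesis
      using Cons.IH[OF P False]
      by (auto simp: reaching_avoiding_def intro: converse_rtrancl_into_rtrancl)
  qed
qed

end

lemma cactus_reaching_avoiding_disjoint:
  assumes "cactus_digraph G" and arcs: "(a, v) \<in> parcs G" "(b, v) \<in> parcs G" and "a \<noteq> b"
  shows "reaching_avoiding (parcs G) v a \<inter> reaching_avoiding (parcs G) v b = {}"
proof (rule ccontr)
  assume "\<not> ?thesis"
  then obtain x where x: "x \<in> reaching_avoiding (parcs G) v a"
    "x \<in> reaching_avoiding (parcs G) v b" by blast
  interpret pair_digraph G using assms(1) by (simp add: cactus_digraph_def)
  have "a \<noteq> v" using pair_no_loops[OF arcs(1)] by simp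
  then have "x \<noteq> v" using x(1) reaching_avoiding_neq by metis
  have "x \<in> pverts G"
    using x(1) reaching_avoiding_subset[of "parcs G" v a] in_arcsD1 arcs(1) by blast
  then have "v \<rightarrow>\<^sup>*\<^bsub>with_proj G\<^esub> x"
    using assms(1) arcs(1) in_arcsD2 by (auto simp: cactus_digraph_def strongly_connected_def)
  then have "(v, x) \<in> (parcs G)\<^sup>*"
    by (auto simp: reachable_def dest: rtrancl_on_rtranclI)
  \<comment> \<open>The arc \<open>(v, y)\<close> will be shared by two cycles, one entering
    \<open>v\<close> from \<open>a\<close> and one from \<open>b\<close>.\<close>
  then obtain y where y: "(v, y) \<in> parcs G" "y \<noteq> v" "(y, x) \<in> (Restr (parcs G) (- {v}))\<^sup>*"
    using first_arc_avoiding \<open>x \<noteq> v\<close> by metis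
  have "\<exists>C. cycle C \<and> (v, y) \<in> set C \<and> {u. (u, v) \<in> set C} = {c}"
    if "(c, v) \<in> parcs G" "x \<in> reaching_avoiding (parcs G) v c" for c
    using cycle_through_arcs[OF y(1,2) that(1)] rtrancl_trans[OF y(3)] that(2)
    by (simp add: reaching_avoiding_def)
  then obtain C D where C: "cycle C" "(v, y) \<in> set C" "{u. (u, v) \<in> set C} = {a}"
    and D: "cycle D" "(v, y) \<in> set D" "{u. (u, v) \<in> set D} = {b}"
    using x arcs by metis
  have "\<lparr>pverts = Field (set C), parcs = set C\<rparr> \<in> simple_cycles G"
    "\<lparr>pverts = Field (set D), parcs = set D\<rparr> \<in> simple_cycles G"
    using C(1) D(1) by (auto simp: simple_cycles_def)
  \<comment> \<open>Only one simple cycle, as a subdigraph, contains \<open>(v, y)\<close>.\<close>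
  then have "\<lparr>pverts = Field (set C), parcs = set C\<rparr> = \<lparr>pverts = Field (set D), parcs = set D\<rparr>"
    using assms(1) y(1) C(2) D(2) unfolding cactus_digraph_def
    by (metis pair_pre_digraph.select_convs(2))
  then have "set C = set D" by simp
  then show False using C(3) D(3) \<open>a \<noteq> b\<close> by auto
qed

text \<open>Arcs of an expansion lift backwards from any vertex over their head, so a walk lifts
  from \<open>a'\<close> backwards. The lift misses \<open>v'\<close> because its image misses
  \<open>\<phi>V v'\<close>.\<close>

lemma expansion_lift_reaching_avoiding:
  assumes exp: "expansion G' G \<phi>V \<phi>A"
    and "u \<in> reaching_avoiding (parcs G) (\<phi>V v') (\<phi>V a')" "a' \<in> pverts G'"
  shows "\<exists>u'. \<phi>V u' = u \<and> u' \<in> pverts G' \<and> u' \<in> reaching_avoiding (parcs G') v' a'"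
  using assms(2) unfolding reaching_avoiding_def mem_Collect_eq
proof (induction rule: converse_rtrancl_induct)
  case base
  then show ?case using assms(3) by auto
next
  case (step y z)
  interpret pair_digraph G' using exp by (simp add: expansion_def)
  obtain z' where z': "\<phi>V z' = z" "z' \<in> pverts G'" "(z', a') \<in> (Restr (parcs G') (- {v'}))\<^sup>*"
    using step.IH by blast
  obtain y' where y': "(y', z') \<in> parcs G'" "\<phi>V y' = y"
    using exp step.hyps(1) z'(1,2) unfolding expansion_def by blast
  have "(y', z') \<in> Restr (parcs G') (- {v'})"
    using y' z'(1) step.hyps(1) by auto
  then show ?case using y' z'(3) in_arcsD1 by (blast intro: converse_rtrancl_into_rtrancl)
qed

text \<open>The last arc is lifted first, at \<open>v'\<close>, and the rest of the path from its
  tail \<open>a'\<close>. Since \<open>a'\<close> lies over the preterminal vertex, paths with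
  different preterminal vertices give different arcs into \<open>v'\<close>.\<close>

lemma expansion_lift_apath:
  assumes "pair_digraph G" and exp: "expansion G' G \<phi>V \<phi>A"
    and P: "pre_digraph.apath (with_proj G) u P (\<phi>V v')" "u \<noteq> \<phi>V v'" and v': "v' \<in> pverts G'"
  shows "\<exists>a'. \<phi>V a' = preterminal P \<and> (a', v') \<in> parcs G' \<and>
    {u' \<in> pverts G'. \<phi>V u' = u} \<inter> reaching_avoiding (parcs G') v' a' \<noteq> {}"
proof -
  interpret G: pair_digraph G by fact
  interpret G': pair_digraph G' using exp by (simp add: expansion_def)
  have u: "u \<in> reaching_avoiding (parcs G) (\<phi>V v') (preterminal P)"
    and pre: "(preterminal P, \<phi>V v') \<in> parcs G"
    using G.apath_imp_reaching_avoiding[OF P] by auto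
  obtain a' where a': "(a', v') \<in> parcs G'" "\<phi>V a' = preterminal P"
    using exp pre v' unfolding expansion_def by blast
  have "a' \<in> pverts G'" using a'(1) by (rule G'.in_arcsD1)
  then show ?thesis
    using expansion_lift_reaching_avoiding[OF exp, of u v' a'] u a' by auto
qed

theorem theorem1:
  fixes G :: "'a pair_pre_digraph" and G' :: "'b pair_pre_digraph"
    and p q :: 'a and \<phi>V :: "'b \<Rightarrow> 'a" and \<phi>A :: "'b \<times> 'b \<Rightarrow> 'a \<times> 'a"
  assumes "pair_digraph G"
    and "doubly_bidirectionally_connected G p q"
    and "expansion G' G \<phi>V \<phi>A"
  shows "\<not> cactus_digraph G'"
proof
  assume cactus: "cactus_digraph G'"
  interpret G': pair_digraph G' using assms(3) by (simp add: expansion_def)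
  \<comment> \<open>Both fibres are taken together, since branching over \<open>p\<close> leads back
    to vertices over \<open>q\<close> and conversely.\<close>
  define T where "T = {v \<in> pverts G'. \<phi>V v \<in> {p, q}}"
  have branch: "\<exists>a b. a \<noteq> b \<and> (a, v) \<in> parcs G' \<and> (b, v) \<in> parcs G' \<and>
      T \<inter> reaching_avoiding (parcs G') v a \<noteq> {} \<and> T \<inter> reaching_avoiding (parcs G') v b \<noteq> {}"
    if "v \<in> T" for v
  proof -
    obtain u P1 P2 where u: "u \<in> {p, q}" "u \<noteq> \<phi>V v"
      and P: "pre_digraph.apath (with_proj G) u P1 (\<phi>V v)"
        "pre_digraph.apath (with_proj G) u P2 (\<phi>V v)"
      and neq: "preterminal P1 \<noteq> preterminal P2"
    proof -
      from \<open>v \<in> T\<close> consider "\<phi>V v = p" | "\<phi>V v = q" by (auto simp: T_def)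
      then show thesis
      proof cases
        case 1
        then show thesis
          using assms(2) that[of q] unfolding doubly_bidirectionally_connected_def by auto
      next
        case 2
        then show thesis
          using assms(2) that[of p] unfolding doubly_bidirectionally_connected_def by auto
      qed
    qed
    have v: "v \<in> pverts G'" using that by (simp add: T_def)
    have sub: "{u' \<in> pverts G'. \<phi>V u' = u} \<subseteq> T" using u(1) by (auto simp: T_def)
    obtain a where a: "\<phi>V a = preterminal P1" "(a, v) \<in> parcs G'"
      "T \<inter> reaching_avoiding (parcs G') v a \<noteq> {}"
      using expansion_lift_apath[OF assms(1,3) P(1) u(2) v] sub by auto
    obtain b where b: "\<phi>V b = preterminal P2" "(b, v) \<in> parcs G'"
      "T \<inter> reaching_avoiding (parcs G') v b \<noteq> {}"
      using expansion_lift_apath[OF assms(1,3) P(2) u(2) v] sub by auto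
    have "a \<noteq> b" using a(1) b(1) neq by auto
    then show ?thesis using a(2,3) b(2,3) by (intro exI conjI)
  qed
  have "T = {}"
  proof (rule reaching_avoiding_descent)
    show "finite (parcs G')" by (rule G'.pair_finite_arcs)
    show "(x, x) \<notin> parcs G'" for x using G'.pair_no_loops by fastforce
  qed (fact cactus_reaching_avoiding_disjoint[OF cactus] branch)+
  \<comment> \<open>Surjectivity on vertices makes the fibre over \<open>p\<close>, hence
    \<open>T\<close>, nonempty.\<close>
  moreover have "p \<in> \<phi>V ` pverts G'"
    using assms(2,3) by (simp add: expansion_def doubly_bidirectionally_connected_def)
  ultimately show False by (auto simp: T_def)
qed

end
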